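(* Let $\lambda\neq0$ be a real number and let $X$ be a smooth vector field on $(H_3,g_1)$. Then $X$ is a matter collineation if and only if $X$ is a Ricci collineation, equivalently if and only if $X$ is a Killing vector field.
   Context: The Heisenberg group $H_3$ is $\mathbb{R}^3$ with global coordinates $(x,y,z)$ and multiplication $(x,y,z)(\tilde x,\tilde y,\tilde z)=(x+\tilde x,y+\tilde y,z+\tilde z-x\tilde y)$. For $\lambda\neq0$, $g_1$ is the left-invariant Lorentzian metric $g_1=-\frac{1}{\lambda^2}dx^2+dy^2+(x\,dy+dz)^2$. With $R(X,Y)=[\nabla_X,\nabla_Y]-\nabla_{[X,Y]}$ the curvature tensor of the Levi-Civita connection, the Ricci tensor is $\varrho(X,Y)=\sum_k g(e_k,e_k)\,g(R(e_k,X)Y,e_k)$ for an orthonormal basis $\{e_k\}$, $\tau$ is the scalar curvature (the $g$-trace of $\varrho$), and $T=\varrho-\frac12\tau g$ is the energy-momentum tensor. A smooth vector field $X$ is Killing if $\mathcal{L}_Xg=0$, a Ricci collineation if $\mathcal{L}_X\varrho=0$, and a matter collineation if $\mathcal{L}_XT=0$. *)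

theory Defs
  imports "HOL-Analysis.Analysis"
begin

text \<open>The Heisenberg group is \<open>real ^ 3\<close> with global coordinates
  \<open>x = p $ 1\<close>, \<open>y = p $ 2\<close>, \<open>z = p $ 3\<close>. All tensor fields are global, and a covariant
  2-tensor field is represented by its action on a pair of vector fields.\<close>

type_synonym scalar_field = "real ^ 3 \<Rightarrow> real"
type_synonym vector_field = "real ^ 3 \<Rightarrow> real ^ 3"
type_synonym tensor2 = "vector_field \<Rightarrow> vector_field \<Rightarrow> scalar_field"
type_synonym connection = "vector_field \<Rightarrow> vector_field \<Rightarrow> vector_field"

fun C_times_diff :: "nat \<Rightarrow> ('a::real_normed_vector \<Rightarrow> 'b::real_normed_vector) \<Rightarrow> bool" where
  "C_times_diff 0 f \<longleftrightarrow> continuous_on UNIV f"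
| "C_times_diff (Suc n) f \<longleftrightarrow>
     (\<forall>p. f differentiable (at p)) \<and> (\<forall>v. C_times_diff n (\<lambda>p. frechet_derivative f (at p) v))"

definition smooth :: "('a::real_normed_vector \<Rightarrow> 'b::real_normed_vector) \<Rightarrow> bool" where
  "smooth f \<longleftrightarrow> (\<forall>n. C_times_diff n f)"

definition dir_deriv :: "vector_field \<Rightarrow> (real ^ 3 \<Rightarrow> 'b::real_normed_vector) \<Rightarrow> real ^ 3 \<Rightarrow> 'b" where
  "dir_deriv X f p = frechet_derivative f (at p) (X p)"

definition lie_bracket :: "vector_field \<Rightarrow> vector_field \<Rightarrow> vector_field" where
  "lie_bracket X Y p = dir_deriv X Y p - dir_deriv Y X p"

definition is_connection :: "connection \<Rightarrow> bool" where
  "is_connection D \<longleftrightarrow>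
     (\<forall>X Y. smooth X \<and> smooth Y \<longrightarrow> smooth (D X Y)) \<and>
     (\<forall>X X' Y p. smooth X \<and> smooth X' \<and> smooth Y \<longrightarrow>
        D (\<lambda>q. X q + X' q) Y p = D X Y p + D X' Y p) \<and>
     (\<forall>(f :: scalar_field) X Y p. smooth f \<and> smooth X \<and> smooth Y \<longrightarrow>
        D (\<lambda>q. f q *\<^sub>R X q) Y p = f p *\<^sub>R D X Y p) \<and>
     (\<forall>X Y Y' p. smooth X \<and> smooth Y \<and> smooth Y' \<longrightarrow>
        D X (\<lambda>q. Y q + Y' q) p = D X Y p + D X Y' p) \<and>
     (\<forall>(f :: scalar_field) X Y p. smooth f \<and> smooth X \<and> smooth Y \<longrightarrow>
        D X (\<lambda>q. f q *\<^sub>R Y q) p = dir_deriv X f p *\<^sub>R Y p + f p *\<^sub>R D X Y p)"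

definition torsion_free :: "connection \<Rightarrow> bool" where
  "torsion_free D \<longleftrightarrow>
     (\<forall>X Y p. smooth X \<and> smooth Y \<longrightarrow> D X Y p - D Y X p = lie_bracket X Y p)"

definition metric_compatible :: "tensor2 \<Rightarrow> connection \<Rightarrow> bool" where
  "metric_compatible g D \<longleftrightarrow>
     (\<forall>X Y Z p. smooth X \<and> smooth Y \<and> smooth Z \<longrightarrow>
        dir_deriv X (g Y Z) p = g (D X Y) Z p + g Y (D X Z) p)"

definition is_levi_civita :: "tensor2 \<Rightarrow> connection \<Rightarrow> bool" where
  "is_levi_civita g D \<longleftrightarrow> is_connection D \<and> torsion_free D \<and> metric_compatible g D"

text \<open>The Levi-Civita connection of a pseudo-Riemannian metric is determined only on smooth
  fields; its values elsewhere are arbitrary, hence the choice operator rather than a definite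
  description. It is applied to smooth fields only.\<close>

definition levi_civita :: "tensor2 \<Rightarrow> connection" where
  "levi_civita g = (SOME D. is_levi_civita g D)"

definition curvature :: "tensor2 \<Rightarrow> vector_field \<Rightarrow> vector_field \<Rightarrow> vector_field \<Rightarrow> vector_field" where
  "curvature g X Y Z p =
     (let D = levi_civita g
      in D X (D Y Z) p - D Y (D X Z) p - D (lie_bracket X Y) Z p)"

definition is_orthonormal_frame :: "tensor2 \<Rightarrow> (3 \<Rightarrow> vector_field) \<Rightarrow> bool" where
  "is_orthonormal_frame g e \<longleftrightarrow>
     (\<forall>k. smooth (e k)) \<and>
     (\<forall>i j p. i \<noteq> j \<longrightarrow> g (e i) (e j) p = 0) \<and>
     (\<forall>k p. \<bar>g (e k) (e k) p\<bar> = 1)"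

text \<open>The traces below do not depend on the orthonormal frame.\<close>

definition orthonormal_frame :: "tensor2 \<Rightarrow> 3 \<Rightarrow> vector_field" where
  "orthonormal_frame g = (SOME e. is_orthonormal_frame g e)"

definition ricci :: "tensor2 \<Rightarrow> tensor2" where
  "ricci g X Y p =
     (let e = orthonormal_frame g
      in \<Sum>k\<in>UNIV. g (e k) (e k) p * g (curvature g (e k) X Y) (e k) p)"

definition scalar_curvature :: "tensor2 \<Rightarrow> scalar_field" where
  "scalar_curvature g p =
     (let e = orthonormal_frame g
      in \<Sum>k\<in>UNIV. g (e k) (e k) p * ricci g (e k) (e k) p)"

definition energy_momentum :: "tensor2 \<Rightarrow> tensor2" where
  "energy_momentum g X Y p = ricci g X Y p - 1 / 2 * scalar_curvature g p * g X Y p"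

definition lie_derivative :: "vector_field \<Rightarrow> tensor2 \<Rightarrow> tensor2" where
  "lie_derivative X S Y Z p =
     dir_deriv X (S Y Z) p - S (lie_bracket X Y) Z p - S Y (lie_bracket X Z) p"

definition lie_derivative_vanishes :: "vector_field \<Rightarrow> tensor2 \<Rightarrow> bool" where
  "lie_derivative_vanishes X S \<longleftrightarrow>
     (\<forall>Y Z p. smooth Y \<and> smooth Z \<longrightarrow> lie_derivative X S Y Z p = 0)"

definition killing :: "tensor2 \<Rightarrow> vector_field \<Rightarrow> bool" where
  "killing g X \<longleftrightarrow> smooth X \<and> lie_derivative_vanishes X g"

definition ricci_collineation :: "tensor2 \<Rightarrow> vector_field \<Rightarrow> bool" where
  "ricci_collineation g X \<longleftrightarrow> smooth X \<and> lie_derivative_vanishes X (ricci g)"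

definition matter_collineation :: "tensor2 \<Rightarrow> vector_field \<Rightarrow> bool" where
  "matter_collineation g X \<longleftrightarrow> smooth X \<and> lie_derivative_vanishes X (energy_momentum g)"

definition heis_mult :: "real ^ 3 \<Rightarrow> real ^ 3 \<Rightarrow> real ^ 3" where
  "heis_mult p q = vector [p $ 1 + q $ 1, p $ 2 + q $ 2, p $ 3 + q $ 3 - p $ 1 * q $ 2]"

definition g1 :: "real \<Rightarrow> tensor2" where
  "g1 l X Y p =
     - (1 / l\<^sup>2) * (X p $ 1) * (Y p $ 1) + (X p $ 2) * (Y p $ 2)
     + (p $ 1 * X p $ 2 + X p $ 3) * (p $ 1 * Y p $ 2 + Y p $ 3)"

lemma heis_mult_has_derivative:
  "(heis_mult a has_derivative
     (\<lambda>v. vector [v $ 1, v $ 2, v $ 3 - a $ 1 * v $ 2])) (at p)"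
proof -
  have "((\<lambda>q. heis_mult a q $ i) has_derivative
      (\<lambda>v. vector [v $ 1, v $ 2, v $ 3 - a $ 1 * v $ 2] $ i)) (at p)" for i :: 3
    using exhaust_3[of i]
    by (auto simp: heis_mult_def intro!: derivative_eq_intros bounded_linear_imp_has_derivative
        bounded_linear_vec_nth)
  then show ?thesis
    by (subst has_derivative_componentwise_within)
       (auto simp: Basis_vec_def inner_axis)
qed

lemma g1_left_invariant:
  assumes "X (heis_mult a p) = frechet_derivative (heis_mult a) (at p) (X p)"
    and "Y (heis_mult a p) = frechet_derivative (heis_mult a) (at p) (Y p)"
  shows "g1 l X Y (heis_mult a p) = g1 l X Y p"
proof -
  have "frechet_derivative (heis_mult a) (at p)
      = (\<lambda>v. vector [v $ 1, v $ 2, v $ 3 - a $ 1 * v $ 2])"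
    using frechet_derivative_at[OF heis_mult_has_derivative[of a p]] by simp
  then show ?thesis
    unfolding g1_def assms by (simp add: heis_mult_def algebra_simps)
qed

end

theory Submission
  imports Defs
begin

text \<open>The left-invariant frame \<open>E\<^sub>1 = l \<partial>\<^sub>x\<close>, \<open>E\<^sub>2 = \<partial>\<^sub>y - x \<partial>\<^sub>z\<close>, \<open>E\<^sub>3 = \<partial>\<^sub>z\<close> is orthonormal
  for the metric, with \<open>E\<^sub>1\<close> timelike, and its only nonzero bracket is \<open>[E\<^sub>1, E\<^sub>2] = - l E\<^sub>3\<close>.
  In the dual coframe \<open>\<theta>\<close>, the metric, the Ricci tensor and the energy-momentum tensor are all
  nonzero multiples of \<open>- \<theta>\<^sub>1\<^sup>2 + \<theta>\<^sub>2\<^sup>2 + m \<theta>\<^sub>3\<^sup>2\<close>, for \<open>m = 1\<close>, \<open>m = - 1\<close> and \<open>m = - 3\<close>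
  respectively. The fields whose flow preserves such a tensor do not depend on \<open>m \<noteq> 0\<close>: a
  differential consequence of the equations is that \<open>E\<^sub>3\<close> annihilates the components along
  \<open>E\<^sub>1\<close> and \<open>E\<^sub>2\<close>, after which \<open>m\<close> drops out.\<close>

subsection \<open>Smooth maps and directional derivatives\<close>

text \<open>Each order asks for differentiability in place of continuity, so the nesting of the
  orders is not immediate. Differentiable maps being continuous gives the base case.\<close>

lemma C_times_diff_Suc_imp: "C_times_diff (Suc n) f \<Longrightarrow> C_times_diff n f"
proof (induction n arbitrary: f)
  case 0
  then show ?case
    by (auto simp: continuous_on_eq_continuous_at intro: differentiable_imp_continuous_within)
next
  case (Suc n)
  have "C_times_diff (Suc n) (\<lambda>p. frechet_derivative f (at p) v)" for v
    using Suc.prems by (simp only: C_times_diff.simps(2)) blast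
  then show ?case
    using Suc by (simp only: C_times_diff.simps(2)[of n f] C_times_diff.simps(2)[of "Suc n" f]) blast
qed

lemma smooth_differentiable: "smooth f \<Longrightarrow> f differentiable (at p)"
  unfolding smooth_def by (metis C_times_diff.simps(2))

lemma smooth_has_derivative:
  "smooth f \<Longrightarrow> (f has_derivative frechet_derivative f (at p)) (at p)"
  using frechet_derivative_works smooth_differentiable by blast

lemma smooth_linear_derivative: "smooth f \<Longrightarrow> linear (frechet_derivative f (at p))"
  by (simp add: linear_frechet_derivative smooth_differentiable)

lemma smooth_frechet_derivative: "smooth f \<Longrightarrow> smooth (\<lambda>p. frechet_derivative f (at p) v)"
  unfolding smooth_def by (metis C_times_diff.simps(2))

lemma C_times_diff_const: "C_times_diff n (\<lambda>p. c)"
  by (induction n arbitrary: c) auto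

lemma smooth_const: "smooth (\<lambda>p. c)"
  by (simp add: smooth_def C_times_diff_const)

text \<open>The derivative of a bounded linear map is the map itself at every point, so each
  directional derivative is constant and a case split on the order suffices.\<close>

lemma smooth_bounded_linear: "bounded_linear f \<Longrightarrow> smooth f"
proof -
  assume f: "bounded_linear f"
  have "C_times_diff n f" for n
  proof (cases n)
    case 0
    then show ?thesis
      using f by (simp add: linear_continuous_on)
  next
    case (Suc m)
    have "frechet_derivative f (at p) = f" for p
      using f by (metis bounded_linear_imp_has_derivative frechet_derivative_at)
    then show ?thesis
      using Suc f C_times_diff_const
      by (auto simp: bounded_linear_imp_differentiable)
  qed
  then show ?thesis
    by (simp add: smooth_def)
qed

lemma frechet_derivative_bilinear:
  assumes "bounded_bilinear B" "f differentiable (at p)" "g differentiable (at p)"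
  shows "frechet_derivative (\<lambda>q. B (f q) (g q)) (at p) v =
    B (f p) (frechet_derivative g (at p) v) + B (frechet_derivative f (at p) v) (g p)"
proof -
  have "((\<lambda>q. B (f q) (g q)) has_derivative
     (\<lambda>v. B (f p) (frechet_derivative g (at p) v) + B (frechet_derivative f (at p) v) (g p))) (at p)"
    by (rule bounded_bilinear.FDERIV[OF assms(1)])
       (use assms(2,3) frechet_derivative_works in blast)+
  then show ?thesis
    using frechet_derivative_at by metis
qed

lemma frechet_derivative_plus:
  assumes "f differentiable (at p)" "g differentiable (at p)"
  shows "frechet_derivative (\<lambda>q. f q + g q) (at p) v =
    frechet_derivative f (at p) v + frechet_derivative g (at p) v"
proof -
  have "((\<lambda>q. f q + g q) has_derivative
     (\<lambda>v. frechet_derivative f (at p) v + frechet_derivative g (at p) v)) (at p)"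
    using assms frechet_derivative_works has_derivative_add by blast
  then show ?thesis
    using frechet_derivative_at by metis
qed

lemma frechet_derivative_bounded_linear:
  assumes "bounded_linear h" "f differentiable (at p)"
  shows "frechet_derivative (\<lambda>q. h (f q)) (at p) v = h (frechet_derivative f (at p) v)"
proof -
  have "((\<lambda>q. h (f q)) has_derivative (\<lambda>v. h (frechet_derivative f (at p) v))) (at p)"
    using assms bounded_linear.has_derivative frechet_derivative_works by blast
  then show ?thesis
    using frechet_derivative_at by metis
qed

lemma C_times_diff_plus:
  "\<lbrakk>C_times_diff n f; C_times_diff n g\<rbrakk> \<Longrightarrow> C_times_diff n (\<lambda>p. f p + g p)"
proof (induction n arbitrary: f g)
  case 0
  then show ?case by (auto intro: continuous_intros)
next
  case (Suc n)
  then show ?case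
    by (simp add: frechet_derivative_plus)
qed

lemma smooth_plus: "\<lbrakk>smooth f; smooth g\<rbrakk> \<Longrightarrow> smooth (\<lambda>p. f p + g p)"
  by (simp add: smooth_def C_times_diff_plus)

text \<open>One product rule serves scalar multiplication, \<open>bform\<close> and the Christoffel
  terms alike. The derivative pairs each factor with a derivative of the other, so the induction
  needs both factors at the lower order as well.\<close>

lemma C_times_diff_bilinear:
  assumes B: "bounded_bilinear B"
  shows "\<lbrakk>C_times_diff n f; C_times_diff n g\<rbrakk> \<Longrightarrow> C_times_diff n (\<lambda>p. B (f p) (g p))"
proof (induction n arbitrary: f g)
  case 0
  then show ?case by (auto intro: bounded_bilinear.continuous_on[OF B])
next
  case (Suc n)
  have "C_times_diff n f" "C_times_diff n g"
    using Suc.prems C_times_diff_Suc_imp by blast+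
  moreover have "(\<lambda>q. B (f q) (g q)) differentiable (at p)" for p
    using Suc.prems bounded_bilinear.FDERIV[OF B] unfolding C_times_diff.simps differentiable_def by blast
  ultimately show ?case
    using Suc by (auto simp: frechet_derivative_bilinear[OF B] intro!: C_times_diff_plus)
qed

lemma smooth_bilinear:
  "\<lbrakk>bounded_bilinear B; smooth f; smooth g\<rbrakk> \<Longrightarrow> smooth (\<lambda>p. B (f p) (g p))"
  by (simp add: smooth_def C_times_diff_bilinear)

lemma smooth_scaleR:
  "\<lbrakk>smooth f; smooth g\<rbrakk> \<Longrightarrow> smooth (\<lambda>p. (f p::real) *\<^sub>R g p)"
  by (rule smooth_bilinear[OF bounded_bilinear_scaleR])

lemma smooth_mult:
  "\<lbrakk>smooth f; smooth g\<rbrakk> \<Longrightarrow> smooth (\<lambda>p. (f p::real) * g p)"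
  by (rule smooth_bilinear[OF bounded_bilinear_mult])

lemma C_times_diff_bounded_linear:
  assumes h: "bounded_linear h"
  shows "C_times_diff n f \<Longrightarrow> C_times_diff n (\<lambda>p. h (f p))"
proof (induction n arbitrary: f)
  case 0
  then show ?case using bounded_linear.continuous_on[OF h] by auto
next
  case (Suc n)
  moreover have "(\<lambda>q. h (f q)) differentiable (at p)" for p
    using Suc.prems bounded_linear.has_derivative[OF h]
    unfolding C_times_diff.simps differentiable_def by blast
  ultimately show ?case
    by (auto simp: frechet_derivative_bounded_linear[OF h])
qed

lemma smooth_compose_linear:
  "\<lbrakk>bounded_linear h; smooth f\<rbrakk> \<Longrightarrow> smooth (\<lambda>p. h (f p))"
  by (simp add: smooth_def C_times_diff_bounded_linear)

lemma smooth_nth: "smooth f \<Longrightarrow> smooth (\<lambda>p. f p $ i)"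
  by (rule smooth_compose_linear[OF bounded_linear_vec_nth])

lemma smooth_coord: "smooth (\<lambda>p. p $ i)"
  by (rule smooth_bounded_linear[OF bounded_linear_vec_nth])

lemma smooth_minus: "\<lbrakk>smooth f; smooth g\<rbrakk> \<Longrightarrow> smooth (\<lambda>p. f p - g p)"
  using smooth_plus[of f "\<lambda>p. - g p"]
    smooth_compose_linear[OF bounded_linear_minus[OF bounded_linear_ident], of g]
  by simp

lemmas smooth_intros = smooth_const smooth_plus smooth_minus smooth_mult smooth_scaleR
  smooth_nth smooth_coord

lemma vector_3_eq: "(vector [a, b, c] :: real ^ 3) = a *\<^sub>R axis 1 1 + b *\<^sub>R axis 2 1 + c *\<^sub>R axis 3 1"
  by (simp add: vec_eq_iff forall_3 axis_def)

lemma vec_3_expand: "(v :: real ^ 3) = v $ 1 *\<^sub>R axis 1 1 + v $ 2 *\<^sub>R axis 2 1 + v $ 3 *\<^sub>R axis 3 1"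
  by (simp add: vec_eq_iff forall_3 axis_def)

lemma smooth_vector_3:
  "\<lbrakk>smooth a; smooth b; smooth c\<rbrakk> \<Longrightarrow> smooth (\<lambda>p. vector [a p, b p, c p] :: real ^ 3)"
  unfolding vector_3_eq by (intro smooth_intros)

text \<open>Smoothness controls derivatives in fixed directions only. Expanding in the standard
  basis moves the dependence of the direction on the point into the coefficients.\<close>

lemma dir_deriv_expand:
  assumes "smooth f"
  shows "dir_deriv X f p = X p $ 1 *\<^sub>R frechet_derivative f (at p) (axis 1 1) +
    X p $ 2 *\<^sub>R frechet_derivative f (at p) (axis 2 1) + X p $ 3 *\<^sub>R frechet_derivative f (at p) (axis 3 1)"
proof -
  have "dir_deriv X f p = frechet_derivative f (at p)
    (X p $ 1 *\<^sub>R axis 1 1 + X p $ 2 *\<^sub>R axis 2 1 + X p $ 3 *\<^sub>R axis 3 1)"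
    unfolding dir_deriv_def using vec_3_expand[of "X p"] by simp
  also have "\<dots> = X p $ 1 *\<^sub>R frechet_derivative f (at p) (axis 1 1) +
    X p $ 2 *\<^sub>R frechet_derivative f (at p) (axis 2 1) + X p $ 3 *\<^sub>R frechet_derivative f (at p) (axis 3 1)"
    using smooth_linear_derivative[OF assms, of p] by (simp add: linear_add linear_scale)
  finally show ?thesis .
qed

lemma smooth_dir_deriv:
  assumes "smooth X" "smooth f"
  shows "smooth (dir_deriv X f)"
proof -
  have "dir_deriv X f = (\<lambda>p. X p $ 1 *\<^sub>R frechet_derivative f (at p) (axis 1 1) +
    X p $ 2 *\<^sub>R frechet_derivative f (at p) (axis 2 1) + X p $ 3 *\<^sub>R frechet_derivative f (at p) (axis 3 1))"
    using dir_deriv_expand[OF assms(2)] by blast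
  then show ?thesis
    by (simp only:) (intro smooth_plus smooth_scaleR smooth_nth smooth_frechet_derivative assms)
qed

lemma smooth_lie_bracket: "\<lbrakk>smooth X; smooth Y\<rbrakk> \<Longrightarrow> smooth (lie_bracket X Y)"
  unfolding lie_bracket_def[abs_def] by (intro smooth_minus smooth_dir_deriv)

lemma dir_deriv_plus:
  "\<lbrakk>smooth f; smooth g\<rbrakk> \<Longrightarrow> dir_deriv X (\<lambda>q. f q + g q) p = dir_deriv X f p + dir_deriv X g p"
  by (simp add: dir_deriv_def frechet_derivative_plus smooth_differentiable)

lemma dir_deriv_const: "dir_deriv X (\<lambda>q. c) p = 0"
  by (simp add: dir_deriv_def)

lemma dir_deriv_bilinear:
  "\<lbrakk>bounded_bilinear B; smooth f; smooth g\<rbrakk> \<Longrightarrow>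
    dir_deriv X (\<lambda>q. B (f q) (g q)) p = B (f p) (dir_deriv X g p) + B (dir_deriv X f p) (g p)"
  by (simp add: dir_deriv_def frechet_derivative_bilinear smooth_differentiable)

lemmas dir_deriv_scaleR = dir_deriv_bilinear[OF bounded_bilinear_scaleR]
lemmas dir_deriv_mult = dir_deriv_bilinear[OF bounded_bilinear_mult]

lemma dir_deriv_compose_linear:
  "\<lbrakk>bounded_linear h; smooth f\<rbrakk> \<Longrightarrow> dir_deriv X (\<lambda>q. h (f q)) p = h (dir_deriv X f p)"
  by (simp add: dir_deriv_def frechet_derivative_bounded_linear smooth_differentiable)

lemmas dir_deriv_nth = dir_deriv_compose_linear[OF bounded_linear_vec_nth]

lemma dir_deriv_coord: "dir_deriv X (\<lambda>q. q $ i) p = X p $ i"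
  unfolding dir_deriv_def
  using bounded_linear_imp_has_derivative[OF bounded_linear_vec_nth] frechet_derivative_at by metis

lemma dir_deriv_minus:
  "\<lbrakk>smooth f; smooth g\<rbrakk> \<Longrightarrow> dir_deriv X (\<lambda>q. f q - g q) p = dir_deriv X f p - dir_deriv X g p"
  using dir_deriv_plus[of f "\<lambda>p. - g p" X p]
    dir_deriv_compose_linear[OF bounded_linear_minus[OF bounded_linear_ident], of g X p]
    smooth_compose_linear[OF bounded_linear_minus[OF bounded_linear_ident], of g]
  by simp

section \<open>Symmetry of second derivatives and the bracket as a commutator\<close>

lemma second_difference_mean_value:
  fixes f :: "'a::real_normed_vector \<Rightarrow> real"
  assumes f: "smooth f" and h: "0 < h"
  obtains s t where "0 < s" "s < h" "0 < t" "t < h"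
    "f (q + h *\<^sub>R v + h *\<^sub>R w) - f (q + h *\<^sub>R v) - f (q + h *\<^sub>R w) + f q =
      h * h * frechet_derivative (\<lambda>p. frechet_derivative f (at p) v) (at (q + s *\<^sub>R v + t *\<^sub>R w)) w"
proof -
  have line: "((\<lambda>s. f (a + s *\<^sub>R v)) has_real_derivative frechet_derivative f (at (a + s *\<^sub>R v)) v) (at s)"
    if f: "smooth f" for f :: "'a \<Rightarrow> real" and a v s
  proof -
    have "((\<lambda>s. a + s *\<^sub>R v) has_derivative (\<lambda>s. s *\<^sub>R v)) (at s)"
      by (auto intro!: derivative_eq_intros)
    from has_derivative_compose[OF this smooth_has_derivative[OF f]]
    show ?thesis
      unfolding has_field_derivative_def
      by (rule back_subst[of "\<lambda>D. (_ has_derivative D) _"])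
        (simp add: linear_scale[OF smooth_linear_derivative[OF f]] fun_eq_iff mult.commute)
  qed
  let ?g = "\<lambda>p. frechet_derivative f (at p) v"
  \<comment> \<open>The increment of this function from \<open>0\<close> to \<open>h\<close> is the
    second difference. The mean value theorem is applied to it along \<open>v\<close>, then to the
    resulting increment of \<open>?g\<close> along \<open>w\<close>.\<close>
  let ?\<psi> = "\<lambda>s. f (q + h *\<^sub>R w + s *\<^sub>R v) - f (q + s *\<^sub>R v)"
  have "(?\<psi> has_real_derivative ?g (q + h *\<^sub>R w + s *\<^sub>R v) - ?g (q + s *\<^sub>R v)) (at s)" for s
    by (intro DERIV_diff line f)
  then obtain s where s: "0 < s" "s < h"
    "?\<psi> h - ?\<psi> 0 = (h - 0) * (?g (q + h *\<^sub>R w + s *\<^sub>R v) - ?g (q + s *\<^sub>R v))"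
    using MVT2[OF h, of ?\<psi> "\<lambda>s. ?g (q + h *\<^sub>R w + s *\<^sub>R v) - ?g (q + s *\<^sub>R v)"] by blast
  obtain t where t: "0 < t" "t < h"
    "?g (q + s *\<^sub>R v + h *\<^sub>R w) - ?g (q + s *\<^sub>R v + 0 *\<^sub>R w) =
      (h - 0) * frechet_derivative ?g (at (q + s *\<^sub>R v + t *\<^sub>R w)) w"
    using MVT2[OF h, of "\<lambda>t. ?g (q + s *\<^sub>R v + t *\<^sub>R w)"
        "\<lambda>t. frechet_derivative ?g (at (q + s *\<^sub>R v + t *\<^sub>R w)) w"]
      line[OF smooth_frechet_derivative[OF f]] by blast
  show ?thesis
    by (rule that[OF s(1,2) t(1,2)]) (use s(3) t(3) in \<open>simp add: algebra_simps\<close>)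
qed

text \<open>The second difference \<open>D n v w\<close> is symmetric in \<open>v\<close> and
  \<open>w\<close>; divided by the squared step it converges to the mixed derivative, so the two
  mixed derivatives are limits of the same sequence.\<close>

lemma frechet_derivative_commute:
  fixes f :: "'a::real_normed_vector \<Rightarrow> real"
  assumes f: "smooth f"
  shows "frechet_derivative (\<lambda>p. frechet_derivative f (at p) v) (at q) w =
    frechet_derivative (\<lambda>p. frechet_derivative f (at p) w) (at q) v"
proof -
  let ?h = "\<lambda>n::nat. inverse (real (Suc n))"
  define G where "G v w = (\<lambda>p. frechet_derivative (\<lambda>p. frechet_derivative f (at p) v) (at p) w)" for v w
  define D where "D n v w = f (q + ?h n *\<^sub>R v + ?h n *\<^sub>R w) - f (q + ?h n *\<^sub>R v) - f (q + ?h n *\<^sub>R w) + f q"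
    for n v w
  have lim: "(\<lambda>n. D n v w / (?h n * ?h n)) \<longlonglongrightarrow> G v w q" for v w
  proof -
    have "\<exists>s t. 0 < s \<and> s < ?h n \<and> 0 < t \<and> t < ?h n \<and>
       D n v w = ?h n * ?h n * G v w (q + s *\<^sub>R v + t *\<^sub>R w)" for n
      using second_difference_mean_value[OF f, of "?h n" q v w] unfolding D_def G_def
      by (metis inverse_positive_iff_positive of_nat_0_less_iff zero_less_Suc)
    then obtain s t where st: "\<And>n. 0 < s n \<and> s n < ?h n \<and> 0 < t n \<and> t n < ?h n \<and>
       D n v w = ?h n * ?h n * G v w (q + s n *\<^sub>R v + t n *\<^sub>R w)"
      by metis
    have "s \<longlonglongrightarrow> 0" "t \<longlonglongrightarrow> 0"
      by (rule tendsto_sandwich[OF _ _ tendsto_const LIMSEQ_inverse_real_of_nat];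
          use st in \<open>auto intro!: always_eventually less_imp_le\<close>)+
    then have "(\<lambda>n. q + s n *\<^sub>R v + t n *\<^sub>R w) \<longlonglongrightarrow> q + 0 *\<^sub>R v + 0 *\<^sub>R w"
      by (intro tendsto_intros)
    \<comment> \<open>The intermediate points tend to \<open>q\<close>; continuity of the second
      derivative there carries the limit over to the quotients.\<close>
    moreover have "smooth (G v w)"
      unfolding G_def by (intro smooth_frechet_derivative f)
    then have "isCont (G v w) q"
      by (simp add: smooth_differentiable differentiable_imp_continuous_within)
    ultimately have "(\<lambda>n. G v w (q + s n *\<^sub>R v + t n *\<^sub>R w)) \<longlonglongrightarrow> G v w q"
      using isCont_tendsto_compose[of q "G v w"] by simp
    moreover have "G v w (q + s n *\<^sub>R v + t n *\<^sub>R w) = D n v w / (?h n * ?h n)" for n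
      using st[of n] by (simp del: of_nat_Suc)
    ultimately show ?thesis
      by simp
  qed
  have "D n v w = D n w v" for n
    unfolding D_def by (simp add: algebra_simps)
  then have "G v w q = G w v q"
    using lim[of v w] lim[of w v] LIMSEQ_unique by simp
  then show ?thesis
    by (simp add: G_def)
qed

text \<open>In the commutator the second derivatives of \<open>f\<close> cancel by symmetry. What
  remains differentiates only the coefficients of the two fields, which is the bracket acting on
  \<open>f\<close>.\<close>

lemma dir_deriv_lie_bracket_real:
  fixes f :: scalar_field
  assumes "smooth X" "smooth Y" "smooth f"
  shows "dir_deriv (lie_bracket X Y) f p = dir_deriv X (dir_deriv Y f) p - dir_deriv Y (dir_deriv X f) p"
proof -
  let ?d = "\<lambda>i p. frechet_derivative f (at p) (axis i 1)"
  have sd: "smooth (?d i)" for i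
    by (intro smooth_frechet_derivative assms)
  have 1: "dir_deriv U (dir_deriv V f) p =
      V p $ 1 * dir_deriv U (?d 1) p + dir_deriv U V p $ 1 * ?d 1 p +
     (V p $ 2 * dir_deriv U (?d 2) p + dir_deriv U V p $ 2 * ?d 2 p) +
     (V p $ 3 * dir_deriv U (?d 3) p + dir_deriv U V p $ 3 * ?d 3 p)"
    if V: "smooth V" for U V
  proof -
    have "dir_deriv V f = (\<lambda>p. V p $ 1 * ?d 1 p + V p $ 2 * ?d 2 p + V p $ 3 * ?d 3 p)"
      using dir_deriv_expand[OF assms(3)] by (simp add: fun_eq_iff)
    then show ?thesis
      using V sd by (simp only: dir_deriv_plus dir_deriv_mult dir_deriv_nth smooth_plus smooth_mult smooth_nth)
  qed
  have 2: "frechet_derivative (?d i) (at p) (axis j 1) = frechet_derivative (?d j) (at p) (axis i 1)" for i j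
    by (rule frechet_derivative_commute[OF assms(3)])
  show ?thesis
    unfolding 1[OF assms(1)] 1[OF assms(2)]
    unfolding dir_deriv_expand[OF sd] dir_deriv_expand[OF assms(3)] lie_bracket_def 2[of 2 1] 2[of 3 1] 2[of 3 2]
    by (simp add: algebra_simps)
qed

lemma dir_deriv_lie_bracket:
  fixes f :: vector_field
  assumes "smooth X" "smooth Y" "smooth f"
  shows "dir_deriv (lie_bracket X Y) f p = dir_deriv X (dir_deriv Y f) p - dir_deriv Y (dir_deriv X f) p"
proof (subst vec_eq_iff, intro allI)
  fix i
  have "dir_deriv U (dir_deriv V f) p $ i = dir_deriv U (dir_deriv V (\<lambda>q. f q $ i)) p"
    if V: "smooth V" for U V
  proof -
    have "dir_deriv V (\<lambda>q. f q $ i) = (\<lambda>p. dir_deriv V f p $ i)"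
      using dir_deriv_nth[OF assms(3)] by blast
    then show ?thesis
      using dir_deriv_nth[OF smooth_dir_deriv[OF V assms(3)]] by simp
  qed
  then show "dir_deriv (lie_bracket X Y) f p $ i =
      (dir_deriv X (dir_deriv Y f) p - dir_deriv Y (dir_deriv X f) p) $ i"
    using dir_deriv_lie_bracket_real[OF assms(1,2) smooth_nth[OF assms(3)], of i p] assms
    by (simp add: dir_deriv_nth)
qed

subsection \<open>The Levi-Civita connection in the frame\<close>

text \<open>The dual coframe \<open>dx / l\<close>, \<open>dy\<close>, \<open>x dy + dz\<close>
  evaluated at \<open>p\<close>; \<open>frame\<close> is its inverse.\<close>

definition coframe :: "real \<Rightarrow> real ^ 3 \<Rightarrow> real ^ 3 \<Rightarrow> real ^ 3" where
  "coframe l p v = vector [v $ 1 / l, v $ 2, p $ 1 * v $ 2 + v $ 3]"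

definition frame :: "real \<Rightarrow> real ^ 3 \<Rightarrow> real ^ 3 \<Rightarrow> real ^ 3" where
  "frame l p w = vector [l * w $ 1, w $ 2, w $ 3 - p $ 1 * w $ 2]"

definition comps :: "real \<Rightarrow> vector_field \<Rightarrow> vector_field" where
  "comps l X p = coframe l p (X p)"

definition bform :: "real \<Rightarrow> real ^ 3 \<Rightarrow> real ^ 3 \<Rightarrow> real" where
  "bform m u v = - u $ 1 * v $ 1 + u $ 2 * v $ 2 + m * u $ 3 * v $ 3"

text \<open>The Heisenberg Lie algebra bracket in the frame, that is, the bracket of two
  left-invariant fields with components \<open>a\<close> and \<open>b\<close>.\<close>

definition frame_bracket :: "real \<Rightarrow> real ^ 3 \<Rightarrow> real ^ 3 \<Rightarrow> real ^ 3" where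
  "frame_bracket l a b = vector [0, 0, l * (a $ 2 * b $ 1 - a $ 1 * b $ 2)]"

text \<open>The coefficients come from the Koszul formula for the orthonormal frame.\<close>
definition frame_christoffel :: "real \<Rightarrow> real ^ 3 \<Rightarrow> real ^ 3 \<Rightarrow> real ^ 3" where
  "frame_christoffel l a b = vector
     [l / 2 * (a $ 2 * b $ 3 + a $ 3 * b $ 2),
      l / 2 * (a $ 1 * b $ 3 + a $ 3 * b $ 1),
      l / 2 * (a $ 2 * b $ 1 - a $ 1 * b $ 2)]"

text \<open>An explicit witness for the choice made in \<open>levi_civita\<close>. In the
  left-invariant frame its correction term has constant coefficients.\<close>

definition heis_connection :: "real \<Rightarrow> connection" where
  "heis_connection l X Y p =
     frame l p (dir_deriv X (comps l Y) p + frame_christoffel l (comps l X p) (comps l Y p))"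

text \<open>The curvature on left-invariant fields: their components are constant, so the derivative
  terms drop out and only algebra is left.\<close>

definition frame_curvature :: "real \<Rightarrow> real ^ 3 \<Rightarrow> real ^ 3 \<Rightarrow> real ^ 3 \<Rightarrow> real ^ 3" where
  "frame_curvature l a b c =
     frame_christoffel l a (frame_christoffel l b c) - frame_christoffel l b (frame_christoffel l a c)
     - frame_christoffel l (frame_bracket l a b) c"

lemma coframe_frame: "l \<noteq> 0 \<Longrightarrow> coframe l p (frame l p w) = w"
  by (simp add: coframe_def frame_def vec_eq_iff forall_3)

lemma frame_coframe: "l \<noteq> 0 \<Longrightarrow> frame l p (coframe l p v) = v"
  by (simp add: coframe_def frame_def vec_eq_iff forall_3)

lemma frame_comps: "l \<noteq> 0 \<Longrightarrow> frame l p (comps l X p) = X p"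
  by (simp add: comps_def frame_coframe)

lemma comps_frame: "l \<noteq> 0 \<Longrightarrow> comps l (\<lambda>p. frame l p (W p)) = W"
  by (simp add: comps_def fun_eq_iff coframe_frame)

lemma comps_eq_iff: "l \<noteq> 0 \<Longrightarrow> comps l X p = comps l Y p \<longleftrightarrow> X p = Y p"
  by (simp add: comps_def) (metis frame_coframe)

lemma linear_frame: "linear (frame l p)"
  by (rule linearI) (simp_all add: frame_def vec_eq_iff forall_3 algebra_simps)

lemma linear_coframe: "linear (coframe l p)"
  by (rule linearI) (simp_all add: coframe_def vec_eq_iff forall_3 algebra_simps add_divide_distrib)

lemmas frame_linear_simps = linear_add[OF linear_frame] linear_diff[OF linear_frame] linear_scale[OF linear_frame]
lemmas coframe_linear_simps =
  linear_add[OF linear_coframe] linear_diff[OF linear_coframe] linear_scale[OF linear_coframe]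

lemma smooth_comps: "smooth X \<Longrightarrow> smooth (comps l X)"
  unfolding comps_def[abs_def] coframe_def divide_inverse
  by (intro smooth_vector_3 smooth_plus smooth_mult smooth_coord smooth_nth smooth_const)

lemma smooth_frame: "smooth W \<Longrightarrow> smooth (\<lambda>p. frame l p (W p))"
  unfolding frame_def
  by (intro smooth_vector_3 smooth_minus smooth_mult smooth_coord smooth_nth smooth_const)

lemma bounded_bilinear_bform: "bounded_bilinear (bform m)"
  unfolding bilinear_conv_bounded_bilinear[symmetric] bilinear_def linear_iff
  by (simp add: bform_def algebra_simps)

lemma bounded_bilinear_frame_christoffel: "bounded_bilinear (frame_christoffel l)"
  unfolding bilinear_conv_bounded_bilinear[symmetric] bilinear_def linear_iff
  by (simp add: frame_christoffel_def vec_eq_iff forall_3 algebra_simps)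

lemma bounded_bilinear_frame_bracket: "bounded_bilinear (frame_bracket l)"
  unfolding bilinear_conv_bounded_bilinear[symmetric] bilinear_def linear_iff
  by (simp add: frame_bracket_def vec_eq_iff forall_3 algebra_simps)

lemmas bform_linear_simps =
  bounded_bilinear.add_left[OF bounded_bilinear_bform] bounded_bilinear.add_right[OF bounded_bilinear_bform]
  bounded_bilinear.diff_left[OF bounded_bilinear_bform] bounded_bilinear.diff_right[OF bounded_bilinear_bform]
  bounded_bilinear.scaleR_left[OF bounded_bilinear_bform] bounded_bilinear.scaleR_right[OF bounded_bilinear_bform]

lemmas christoffel_linear_simps =
  bounded_bilinear.add_left[OF bounded_bilinear_frame_christoffel]
  bounded_bilinear.add_right[OF bounded_bilinear_frame_christoffel]
  bounded_bilinear.diff_left[OF bounded_bilinear_frame_christoffel]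
  bounded_bilinear.diff_right[OF bounded_bilinear_frame_christoffel]
  bounded_bilinear.scaleR_left[OF bounded_bilinear_frame_christoffel]
  bounded_bilinear.scaleR_right[OF bounded_bilinear_frame_christoffel]

lemma bform_commute: "bform m u v = bform m v u"
  by (simp add: bform_def)

text \<open>This identity and \<open>christoffel_metric\<close> are the algebraic content of
  vanishing torsion and metric compatibility; the derivative terms match by the product
  rule.\<close>

lemma christoffel_torsion: "frame_christoffel l a b - frame_christoffel l b a = frame_bracket l a b"
  by (simp add: frame_christoffel_def frame_bracket_def vec_eq_iff forall_3 algebra_simps)

lemma christoffel_metric: "bform 1 (frame_christoffel l a b) c + bform 1 b (frame_christoffel l a c) = 0"
  by (simp add: frame_christoffel_def bform_def algebra_simps)

lemma g1_eq_bform: "g1 l X Y p = bform 1 (comps l X p) (comps l Y p)"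
  by (simp add: g1_def bform_def comps_def coframe_def power2_eq_square)

text \<open>The structure constants arise from the third coframe entry, whose coefficient
  \<open>x\<close> depends on the point. Differentiating it produces \<open>frame_bracket\<close>,
  with the factor \<open>l\<close> undoing the scaling of the first component.\<close>

lemma comps_lie_bracket:
  assumes l: "l \<noteq> 0" and X: "smooth X" and Y: "smooth Y"
  shows "comps l (lie_bracket X Y) p =
    dir_deriv X (comps l Y) p - dir_deriv Y (comps l X) p + frame_bracket l (comps l X p) (comps l Y p)"
proof -
  have 1: "dir_deriv U (comps l V) p $ 1 = dir_deriv U V p $ 1 / l"
    and 2: "dir_deriv U (comps l V) p $ 2 = dir_deriv U V p $ 2"
    and 3: "dir_deriv U (comps l V) p $ 3 =
      p $ 1 * dir_deriv U V p $ 2 + U p $ 1 * V p $ 2 + dir_deriv U V p $ 3"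
    if V: "smooth V" for U V
  proof -
    note c = dir_deriv_nth[OF smooth_comps[OF V], symmetric]
    show "dir_deriv U (comps l V) p $ 1 = dir_deriv U V p $ 1 / l"
      unfolding c
      using dir_deriv_compose_linear[OF bounded_linear_divide[of l] smooth_nth[OF V, of 1], of U p]
      by (simp add: comps_def coframe_def dir_deriv_nth V)
    show "dir_deriv U (comps l V) p $ 2 = dir_deriv U V p $ 2"
      unfolding c by (simp add: comps_def coframe_def dir_deriv_nth V)
    have "dir_deriv U (comps l V) p $ 3 = dir_deriv U (\<lambda>q. q $ 1 * V q $ 2 + V q $ 3) p"
      unfolding c by (simp add: comps_def coframe_def)
    then show "dir_deriv U (comps l V) p $ 3 =
      p $ 1 * dir_deriv U V p $ 2 + U p $ 1 * V p $ 2 + dir_deriv U V p $ 3"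
      by (simp add: dir_deriv_plus dir_deriv_mult dir_deriv_coord dir_deriv_nth
          smooth_nth smooth_mult smooth_coord V)
  qed
  show ?thesis
    using l
    by (simp add: vec_eq_iff forall_3 1[OF X] 1[OF Y] 2[OF X] 2[OF Y] 3[OF X] 3[OF Y])
       (simp add: comps_def coframe_def frame_bracket_def lie_bracket_def field_simps)
qed

section \<open>Existence of the Levi-Civita connection\<close>

lemma comps_heis_connection:
  "l \<noteq> 0 \<Longrightarrow> comps l (heis_connection l X Y) p =
     dir_deriv X (comps l Y) p + frame_christoffel l (comps l X p) (comps l Y p)"
  by (simp add: comps_def[of _ "heis_connection l X Y"] heis_connection_def coframe_frame)

lemma smooth_heis_connection: "\<lbrakk>smooth X; smooth Y\<rbrakk> \<Longrightarrow> smooth (heis_connection l X Y)"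
  unfolding heis_connection_def[abs_def]
  by (intro smooth_frame smooth_plus smooth_dir_deriv smooth_comps
      smooth_bilinear[OF bounded_bilinear_frame_christoffel])

lemma comps_plus: "comps l (\<lambda>q. X q + Y q) p = comps l X p + comps l Y p"
  by (simp add: comps_def coframe_linear_simps)

lemma comps_scaleR: "comps l (\<lambda>q. f q *\<^sub>R X q) p = f p *\<^sub>R comps l X p"
  by (simp add: comps_def coframe_linear_simps)

lemma is_connection_heis_connection:
  assumes l: "l \<noteq> 0"
  shows "is_connection (heis_connection l)"
  unfolding is_connection_def
proof (intro conjI allI impI; (elim conjE)?)
  fix X Y :: vector_field
  assume "smooth X" "smooth Y"
  then show "smooth (heis_connection l X Y)"
    by (rule smooth_heis_connection)
next
  fix X X' Y :: vector_field and p
  assume "smooth X" "smooth X'" "smooth Y"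
  then show "heis_connection l (\<lambda>q. X q + X' q) Y p = heis_connection l X Y p + heis_connection l X' Y p"
    by (simp add: heis_connection_def comps_plus dir_deriv_def christoffel_linear_simps
        linear_add[OF smooth_linear_derivative] smooth_comps frame_linear_simps)
next
  fix f :: scalar_field and X Y :: vector_field and p
  assume "smooth f" "smooth X" "smooth Y"
  then show "heis_connection l (\<lambda>q. f q *\<^sub>R X q) Y p = f p *\<^sub>R heis_connection l X Y p"
    by (simp add: heis_connection_def comps_scaleR dir_deriv_def christoffel_linear_simps
        linear_scale[OF smooth_linear_derivative] smooth_comps frame_linear_simps scaleR_add_right)
next
  fix X Y Y' :: vector_field and p
  assume "smooth X" "smooth Y" "smooth Y'"
  then show "heis_connection l X (\<lambda>q. Y q + Y' q) p = heis_connection l X Y p + heis_connection l X Y' p"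
    by (simp add: heis_connection_def comps_plus[abs_def] dir_deriv_plus christoffel_linear_simps
        smooth_comps frame_linear_simps)
next
  fix f :: scalar_field and X Y :: vector_field and p
  assume "smooth f" "smooth X" "smooth Y"
  then show "heis_connection l X (\<lambda>q. f q *\<^sub>R Y q) p =
      dir_deriv X f p *\<^sub>R Y p + f p *\<^sub>R heis_connection l X Y p"
    by (simp add: heis_connection_def comps_scaleR[abs_def] dir_deriv_scaleR christoffel_linear_simps
        smooth_comps frame_linear_simps scaleR_add_right frame_comps l)
qed

lemma is_levi_civita_heis_connection:
  assumes l: "l \<noteq> 0"
  shows "is_levi_civita (g1 l) (heis_connection l)"
  unfolding is_levi_civita_def
proof (intro conjI is_connection_heis_connection l)
  show "torsion_free (heis_connection l)"
    unfolding torsion_free_def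
  proof (intro allI impI, elim conjE)
    fix X Y :: vector_field and p
    assume XY: "smooth X" "smooth Y"
    have "heis_connection l X Y p - heis_connection l Y X p = frame l p (comps l (lie_bracket X Y) p)"
      unfolding comps_lie_bracket[OF l XY] heis_connection_def christoffel_torsion[symmetric]
      by (simp add: frame_linear_simps)
    then show "heis_connection l X Y p - heis_connection l Y X p = lie_bracket X Y p"
      by (simp add: frame_comps l)
  qed
next
  show "metric_compatible (g1 l) (heis_connection l)"
    unfolding metric_compatible_def
  proof (intro allI impI, elim conjE)
    fix X Y Z :: vector_field and p
    assume "smooth X" "smooth Y" "smooth Z"
    then show "dir_deriv X (g1 l Y Z) p =
        g1 l (heis_connection l X Y) Z p + g1 l Y (heis_connection l X Z) p"
      using christoffel_metric[of l "comps l X p" "comps l Y p" "comps l Z p"]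
      by (simp add: g1_eq_bform[abs_def] comps_heis_connection l bform_linear_simps smooth_comps
          dir_deriv_bilinear[OF bounded_bilinear_bform])
  qed
qed

section \<open>Uniqueness of the Levi-Civita connection, and its curvature\<close>

lemma bform_nondegenerate:
  assumes "\<And>w. bform 1 u w = bform 1 v w"
  shows "u = v"
  using assms[of "axis 1 1"] assms[of "axis 2 1"] assms[of "axis 3 1"]
  by (simp add: bform_def axis_def vec_eq_iff forall_3)

lemma levi_civita_unique:
  assumes l: "l \<noteq> 0" and D: "is_levi_civita (g1 l) D" and D': "is_levi_civita (g1 l) D'"
    and X: "smooth X" and Y: "smooth Y"
  shows "D X Y p = D' X Y p"
proof -
  \<comment> \<open>The difference tensor is symmetric in its first two slots and skew in its last two, hence zero.\<close>
  define c where "c X Y Z = g1 l (D X Y) Z p - g1 l (D' X Y) Z p" for X Y Z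
  have g1_diff: "g1 l U Z p - g1 l V Z p = bform 1 (coframe l p (U p - V p)) (comps l Z p)" for U V Z
    by (simp add: g1_eq_bform comps_def coframe_linear_simps bform_linear_simps)
  have sym: "c X Y Z = c Y X Z" if "smooth X" "smooth Y" for X Y Z
  proof -
    have "D X Y p - D Y X p = D' X Y p - D' Y X p"
      using D D' that by (simp add: is_levi_civita_def torsion_free_def)
    then have "D X Y p - D' X Y p = D Y X p - D' Y X p"
      by (simp add: algebra_simps)
    then show ?thesis
      by (simp add: c_def g1_diff)
  qed
  have skew: "c X Y Z = - c X Z Y" if "smooth X" "smooth Y" "smooth Z" for X Y Z
  proof -
    have "g1 l (D X Y) Z p + g1 l Y (D X Z) p = g1 l (D' X Y) Z p + g1 l Y (D' X Z) p"
      using D D' that by (metis is_levi_civita_def metric_compatible_def)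
    then show ?thesis
      by (simp add: c_def g1_eq_bform bform_commute[of 1 "comps l Y p"])
  qed
  have "c X Y Z = 0" if Z: "smooth Z" for Z
    using sym[OF X Y, of Z] skew[OF Y X Z] sym[OF Y Z, of X] skew[OF Z Y X] sym[OF Z X, of Y] skew[OF X Z Y]
    by linarith
  \<comment> \<open>Left-invariant test fields take every value at \<open>p\<close>, so
    nondegeneracy of the metric applies.\<close>
  then have "c X Y (\<lambda>q. frame l q w) = 0" for w
    by (simp add: smooth_frame smooth_const)
  then have "bform 1 (comps l (D X Y) p) w = bform 1 (comps l (D' X Y) p) w" for w
    by (simp add: c_def g1_eq_bform comps_frame l)
  then have "comps l (D X Y) p = comps l (D' X Y) p"
    by (rule bform_nondegenerate)
  then show ?thesis
    using l by (simp add: comps_eq_iff)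
qed

text \<open>A Levi-Civita connection exists, so the chosen one has its defining properties, and
  uniqueness identifies it on smooth fields.\<close>

lemma levi_civita_g1:
  assumes l: "l \<noteq> 0" and "smooth X" "smooth Y"
  shows "levi_civita (g1 l) X Y = heis_connection l X Y"
proof
  have "is_levi_civita (g1 l) (levi_civita (g1 l))"
    unfolding levi_civita_def using is_levi_civita_heis_connection[OF l] by (rule someI[of "is_levi_civita (g1 l)"])
  then show "levi_civita (g1 l) X Y p = heis_connection l X Y p" for p
    using levi_civita_unique[OF l _ is_levi_civita_heis_connection[OF l] assms(2,3)] by blast
qed

text \<open>Second derivatives of \<open>Z\<close> cancel against the derivative along the bracket,
  and the terms with one derivative of \<open>Z\<close> are symmetric in \<open>X\<close> and
  \<open>Y\<close>. Derivatives of \<open>X\<close> and \<open>Y\<close> cancel against those in the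
  components of the bracket, leaving only its structure constants.\<close>

lemma comps_curvature_g1:
  assumes l: "l \<noteq> 0" and X: "smooth X" and Y: "smooth Y" and Z: "smooth Z"
  shows "comps l (curvature (g1 l) X Y Z) p = frame_curvature l (comps l X p) (comps l Y p) (comps l Z p)"
proof -
  let ?D = "heis_connection l"
  have DD: "comps l (?D U (?D V Z)) p =
      dir_deriv U (dir_deriv V (comps l Z)) p +
      (frame_christoffel l (comps l V p) (dir_deriv U (comps l Z) p) +
       frame_christoffel l (dir_deriv U (comps l V) p) (comps l Z p)) +
      (frame_christoffel l (comps l U p) (dir_deriv V (comps l Z) p) +
       frame_christoffel l (comps l U p) (frame_christoffel l (comps l V p) (comps l Z p)))"
    if UV: "smooth U" "smooth V" for U V
  proof -
    have "comps l (?D V Z) = (\<lambda>p. dir_deriv V (comps l Z) p + frame_christoffel l (comps l V p) (comps l Z p))"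
      using comps_heis_connection[OF l] by blast
    then show ?thesis
      using UV Z
      by (simp add: comps_heis_connection[OF l] dir_deriv_plus smooth_dir_deriv smooth_comps
          smooth_bilinear[OF bounded_bilinear_frame_christoffel]
          dir_deriv_bilinear[OF bounded_bilinear_frame_christoffel] christoffel_linear_simps)
  qed
  have "curvature (g1 l) X Y Z p = ?D X (?D Y Z) p - ?D Y (?D X Z) p - ?D (lie_bracket X Y) Z p"
    by (simp add: curvature_def Let_def levi_civita_g1 l X Y Z smooth_heis_connection smooth_lie_bracket)
  then have "comps l (curvature (g1 l) X Y Z) p =
      comps l (?D X (?D Y Z)) p - comps l (?D Y (?D X Z)) p - comps l (?D (lie_bracket X Y) Z) p"
    by (simp add: comps_def[of _ "curvature (g1 l) X Y Z"] comps_def[of _ "?D U V" for U V] coframe_linear_simps)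
  then show ?thesis
    unfolding DD[OF X Y] DD[OF Y X] comps_heis_connection[OF l, of "lie_bracket X Y"]
      comps_lie_bracket[OF l X Y] dir_deriv_lie_bracket[OF X Y smooth_comps[OF Z]] frame_curvature_def
    by (simp add: christoffel_linear_simps)
qed

subsection \<open>Ricci and energy-momentum tensors\<close>

lemma is_orthonormal_frame_g1:
  assumes l: "l \<noteq> 0"
  shows "is_orthonormal_frame (g1 l) (\<lambda>k p. frame l p (axis k 1))"
  unfolding is_orthonormal_frame_def
  by (simp add: smooth_frame smooth_const g1_eq_bform comps_frame l forall_3)
     (simp add: bform_def axis_def)

lemma orthonormal_frame_g1:
  assumes l: "l \<noteq> 0"
  shows "is_orthonormal_frame (g1 l) (orthonormal_frame (g1 l))"
  unfolding orthonormal_frame_def using is_orthonormal_frame_g1[OF l] by (rule someI[of "is_orthonormal_frame (g1 l)"])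

text \<open>Orthonormality says that the matrix \<open>M\<close> with rows \<open>A k\<close> has
  right inverse \<open>N\<close>, built from the transpose and the signs. A right inverse of a
  square matrix is a left inverse, and \<open>N ** M = mat 1\<close> is the completeness
  relation.\<close>

lemma orthonormal_outer_sum:
  fixes A :: "3 \<Rightarrow> real ^ 3"
  assumes orth: "\<And>i j. i \<noteq> j \<Longrightarrow> bform 1 (A i) (A j) = 0"
    and unit: "\<And>i. \<bar>bform 1 (A i) (A i)\<bar> = 1"
  shows "(\<Sum>k\<in>UNIV. bform 1 (A k) (A k) * (A k $ a * A k $ b)) =
    (if a = b then if a = 1 then - 1 else 1 else 0)"
proof -
  define s where "s k = bform 1 (A k) (A k)" for k
  define n where "n a = (if a = 1 then - 1 else 1 :: real)" for a :: 3
  define M where "M = (\<chi> k a. A k $ a)"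
  define N where "N = (\<chi> a k. n a * s k * A k $ a)"
  have ss: "s k * s k = 1" for k
    using unit[of k] by (auto simp: s_def abs_if split: if_splits)
  have "(M ** N) $ i $ j = s j * bform 1 (A i) (A j)" for i j
    by (simp add: M_def N_def matrix_matrix_mult_def sum_3 n_def bform_def algebra_simps)
  then have "(M ** N) $ i $ j = mat 1 $ i $ j" for i j
    using orth[of i j] ss[of j] by (cases "i = j") (simp_all add: mat_def s_def)
  then have "M ** N = mat 1"
    by (simp add: vec_eq_iff)
  then have "(N ** M) $ a $ b = mat 1 $ a $ b"
    using matrix_left_right_inverse[of M N] by simp
  then have "n a * (\<Sum>k\<in>UNIV. s k * (A k $ a * A k $ b)) = (if a = b then 1 else 0)"
    by (simp add: M_def N_def matrix_matrix_mult_def sum_distrib_left mat_def mult.assoc)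
  then show ?thesis
    by (auto simp: n_def s_def split: if_splits)
qed

text \<open>By bilinearity the sum depends on the vectors only through their completeness relation.
  Hence traces over the frame picked by the choice operator can be computed on the standard
  basis.\<close>

lemma orthonormal_trace:
  fixes A :: "3 \<Rightarrow> real ^ 3" and Q :: "real ^ 3 \<Rightarrow> real ^ 3 \<Rightarrow> real"
  assumes orth: "\<And>i j. i \<noteq> j \<Longrightarrow> bform 1 (A i) (A j) = 0"
    and unit: "\<And>i. \<bar>bform 1 (A i) (A i)\<bar> = 1"
    and Q: "bounded_bilinear Q"
  shows "(\<Sum>k\<in>UNIV. bform 1 (A k) (A k) * Q (A k) (A k)) =
    - Q (axis 1 1) (axis 1 1) + Q (axis 2 1) (axis 2 1) + Q (axis 3 1) (axis 3 1)"
proof -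
  have outer: "(\<Sum>k\<in>UNIV. bform 1 (A k) (A k) * (A k $ a * A k $ b)) =
    (if a = b then if a = 1 then - 1 else 1 else 0)" for a b
    by (rule orthonormal_outer_sum) (fact orth, fact unit)
  have ax: "v = (\<Sum>i\<in>UNIV. v $ i *\<^sub>R axis i 1)" for v :: "real ^ 3"
    using basis_expansion[of v] by (simp add: scalar_mult_eq_scaleR)
  have "Q v v = (\<Sum>i\<in>UNIV. \<Sum>j\<in>UNIV. v $ i * v $ j * Q (axis i 1) (axis j 1))" for v
  proof -
    have "Q v v = Q (\<Sum>i\<in>UNIV. v $ i *\<^sub>R axis i 1) (\<Sum>j\<in>UNIV. v $ j *\<^sub>R axis j 1)"
      using ax[of v] by simp
    then show ?thesis
      by (subst sum.swap) (simp add: bounded_bilinear.sum_left[OF Q] bounded_bilinear.sum_right[OF Q]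
          bounded_bilinear.scaleR_left[OF Q] bounded_bilinear.scaleR_right[OF Q]
          sum_distrib_left mult_ac)
  qed
  then have "(\<Sum>k\<in>UNIV. bform 1 (A k) (A k) * Q (A k) (A k)) =
      (\<Sum>k\<in>UNIV. \<Sum>i\<in>UNIV. \<Sum>j\<in>UNIV. bform 1 (A k) (A k) * (A k $ i * A k $ j) * Q (axis i 1) (axis j 1))"
    by (simp add: sum_distrib_left mult.assoc)
  also have "\<dots> = (\<Sum>i\<in>UNIV. \<Sum>j\<in>UNIV. \<Sum>k\<in>UNIV.
      bform 1 (A k) (A k) * (A k $ i * A k $ j) * Q (axis i 1) (axis j 1))"
    by (subst sum.swap) (rule sum.cong[OF refl], rule sum.swap)
  also have "\<dots> = (\<Sum>i\<in>UNIV. \<Sum>j\<in>UNIV.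
      (if i = j then if i = 1 then - 1 else 1 else 0) * Q (axis i 1) (axis j 1))"
    unfolding sum_distrib_right[symmetric] outer ..
  also have "\<dots> = - Q (axis 1 1) (axis 1 1) + Q (axis 2 1) (axis 2 1) + Q (axis 3 1) (axis 3 1)"
    by (simp add: sum_3)
  finally show ?thesis .
qed

lemma bounded_bilinear_frame_curvature:
  "bounded_bilinear (\<lambda>a b. bform 1 (frame_curvature l a u v) b)"
  unfolding bilinear_conv_bounded_bilinear[symmetric] bilinear_def linear_iff frame_curvature_def
  by (simp add: bform_linear_simps christoffel_linear_simps algebra_simps
      bounded_bilinear.add_left[OF bounded_bilinear_frame_bracket]
      bounded_bilinear.scaleR_left[OF bounded_bilinear_frame_bracket])

lemma ricci_g1:
  assumes l: "l \<noteq> 0" and X: "smooth X" and Y: "smooth Y"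
  shows "ricci (g1 l) X Y p = l\<^sup>2 / 2 * bform (- 1) (comps l X p) (comps l Y p)"
proof -
  let ?e = "orthonormal_frame (g1 l)"
  let ?u = "comps l X p" and ?v = "comps l Y p"
  let ?Q = "\<lambda>a b. bform 1 (frame_curvature l a ?u ?v) b"
  note e = orthonormal_frame_g1[OF l, unfolded is_orthonormal_frame_def]
  have se: "smooth (?e k)" for k
    using e by blast
  have "ricci (g1 l) X Y p = (\<Sum>k\<in>UNIV. bform 1 (comps l (?e k) p) (comps l (?e k) p) *
      ?Q (comps l (?e k) p) (comps l (?e k) p))"
    by (simp add: ricci_def Let_def g1_eq_bform comps_curvature_g1[OF l se X Y])
  also have "\<dots> = - ?Q (axis 1 1) (axis 1 1) + ?Q (axis 2 1) (axis 2 1) + ?Q (axis 3 1) (axis 3 1)"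
    by (rule orthonormal_trace[OF _ _ bounded_bilinear_frame_curvature])
       (use e in \<open>simp_all add: g1_eq_bform\<close>)
  \<comment> \<open>Expanding the constant coefficients gives a diagonal Ricci tensor with entries
    \<open>- 1\<close>, \<open>1\<close>, \<open>- 1\<close> times \<open>l^2 / 2\<close>.\<close>
  also have "\<dots> = l\<^sup>2 / 2 * bform (- 1) ?u ?v"
    by (simp add: bform_def frame_curvature_def frame_christoffel_def frame_bracket_def axis_def
        power2_eq_square algebra_simps)
  finally show ?thesis .
qed

lemma scalar_curvature_g1:
  assumes l: "l \<noteq> 0"
  shows "scalar_curvature (g1 l) p = l\<^sup>2 / 2"
proof -
  let ?e = "orthonormal_frame (g1 l)"
  note e = orthonormal_frame_g1[OF l, unfolded is_orthonormal_frame_def]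
  have se: "smooth (?e k)" for k
    using e by blast
  have "scalar_curvature (g1 l) p = l\<^sup>2 / 2 * (\<Sum>k\<in>UNIV. bform 1 (comps l (?e k) p) (comps l (?e k) p) *
      bform (- 1) (comps l (?e k) p) (comps l (?e k) p))"
    by (simp add: scalar_curvature_def Let_def g1_eq_bform ricci_g1[OF l se se] sum_distrib_left mult_ac)
  also have "(\<Sum>k\<in>UNIV. bform 1 (comps l (?e k) p) (comps l (?e k) p) *
      bform (- 1) (comps l (?e k) p) (comps l (?e k) p)) =
      - bform (- 1) (axis 1 1) (axis 1 1) + bform (- 1) (axis 2 1) (axis 2 1) + bform (- 1) (axis 3 1) (axis 3 1)"
    by (rule orthonormal_trace[OF _ _ bounded_bilinear_bform])
       (use e in \<open>simp_all add: g1_eq_bform\<close>)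
  also have "\<dots> = 1"
    by (simp add: bform_def axis_def)
  finally show ?thesis by simp
qed

text \<open>Half the scalar curvature is \<open>l^2 / 4\<close>. Subtracting that multiple of the
  metric leaves \<open>l^2 / 4\<close> in front of the first two squares and turns the last
  coefficient into \<open>- l^2 / 2 - l^2 / 4\<close>, whence the \<open>- 3\<close>.\<close>

lemma energy_momentum_g1:
  assumes "l \<noteq> 0" "smooth X" "smooth Y"
  shows "energy_momentum (g1 l) X Y p = l\<^sup>2 / 4 * bform (- 3) (comps l X p) (comps l Y p)"
  by (simp add: energy_momentum_def ricci_g1 scalar_curvature_g1 assms g1_eq_bform)
     (simp add: bform_def algebra_simps)

subsection \<open>Collineations\<close>

definition frame_field :: "real \<Rightarrow> 3 \<Rightarrow> vector_field" where
  "frame_field l i p = frame l p (axis i 1)"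

definition frame_deriv :: "real \<Rightarrow> 3 \<Rightarrow> scalar_field \<Rightarrow> scalar_field" where
  "frame_deriv l i f = dir_deriv (frame_field l i) f"

lemma smooth_frame_field: "smooth (frame_field l i)"
  unfolding frame_field_def[abs_def] by (intro smooth_frame smooth_const)

lemma smooth_frame_deriv: "smooth f \<Longrightarrow> smooth (frame_deriv l i f)"
  unfolding frame_deriv_def by (intro smooth_dir_deriv smooth_frame_field)

lemma comps_frame_field: "l \<noteq> 0 \<Longrightarrow> comps l (frame_field l i) = (\<lambda>p. axis i 1)"
  unfolding frame_field_def[abs_def] by (rule comps_frame)

text \<open>The components of the frame fields are constant, so their bracket reduces to structure
  constants and is always a multiple of \<open>E_3\<close>.\<close>

lemma frame_deriv_commutator:
  assumes l: "l \<noteq> 0" and f: "smooth f"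
  shows "frame_deriv l i (frame_deriv l j f) p - frame_deriv l j (frame_deriv l i f) p =
    frame_bracket l (axis i 1) (axis j 1) $ 3 * frame_deriv l 3 f p"
proof -
  let ?B = "lie_bracket (frame_field l i) (frame_field l j)"
  have "?B p = frame l p (comps l ?B p)"
    by (simp add: frame_comps l)
  also have "comps l ?B p = frame_bracket l (axis i 1) (axis j 1) $ 3 *\<^sub>R axis 3 1"
    by (simp add: comps_lie_bracket l smooth_frame_field comps_frame_field dir_deriv_const)
       (simp add: frame_bracket_def vec_eq_iff forall_3 axis_def)
  finally have "?B p = frame_bracket l (axis i 1) (axis j 1) $ 3 *\<^sub>R frame_field l 3 p"
    by (simp add: frame_linear_simps frame_field_def[of l 3])
  then have "dir_deriv ?B f p = frame_bracket l (axis i 1) (axis j 1) $ 3 * frame_deriv l 3 f p"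
    by (simp add: frame_deriv_def dir_deriv_def linear_scale[OF smooth_linear_derivative[OF f]])
  then show ?thesis
    by (simp add: frame_deriv_def dir_deriv_lie_bracket_real smooth_frame_field f)
qed

lemma frame_deriv_commutators:
  assumes "l \<noteq> 0" "smooth f"
  shows "frame_deriv l 1 (frame_deriv l 2 f) p = frame_deriv l 2 (frame_deriv l 1 f) p - l * frame_deriv l 3 f p"
    and "frame_deriv l 1 (frame_deriv l 3 f) p = frame_deriv l 3 (frame_deriv l 1 f) p"
    and "frame_deriv l 2 (frame_deriv l 3 f) p = frame_deriv l 3 (frame_deriv l 2 f) p"
  using frame_deriv_commutator[OF assms, of 1 2 p] frame_deriv_commutator[OF assms, of 1 3 p]
    frame_deriv_commutator[OF assms, of 2 3 p]
  by (simp_all add: frame_bracket_def axis_def)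

text \<open>At a point, \<open>frame_lie l X p\<close> is the endomorphism \<open>Y \<mapsto> - [X, Y]\<close> restricted to
  left-invariant \<open>Y\<close>; unlike the bracket, it needs no derivative of \<open>Y\<close>.\<close>
definition frame_lie :: "real \<Rightarrow> vector_field \<Rightarrow> real ^ 3 \<Rightarrow> real ^ 3 \<Rightarrow> real ^ 3" where
  "frame_lie l X p w =
     frechet_derivative (comps l X) (at p) (frame l p w) - frame_bracket l (comps l X p) w"

text \<open>The product rule pairs the derivative of each argument's components with the bracket
  term. In their difference the derivative of the argument cancels and \<open>frame_lie\<close>
  remains, so the value at \<open>p\<close> is algebraic in the arguments.\<close>

lemma lie_derivative_bform:
  assumes l: "l \<noteq> 0" and X: "smooth X" and Y: "smooth Y" and Z: "smooth Z"
    and S: "\<forall>Y Z p. smooth Y \<longrightarrow> smooth Z \<longrightarrow> S Y Z p = c * bform m (comps l Y p) (comps l Z p)"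
  shows "lie_derivative X S Y Z p =
    c * (bform m (frame_lie l X p (comps l Y p)) (comps l Z p) +
         bform m (comps l Y p) (frame_lie l X p (comps l Z p)))"
proof -
  have fl: "frame_lie l X p (comps l W p) =
      dir_deriv X (comps l W) p - comps l (lie_bracket X W) p" if "smooth W" for W
    using that by (simp add: frame_lie_def comps_lie_bracket l X frame_comps dir_deriv_def)
  have "S Y Z = (\<lambda>p. c * bform m (comps l Y p) (comps l Z p))"
    using S Y Z by blast
  then have "dir_deriv X (S Y Z) p = c * (bform m (comps l Y p) (dir_deriv X (comps l Z) p) +
      bform m (dir_deriv X (comps l Y) p) (comps l Z p))"
    by (simp add: dir_deriv_mult smooth_const dir_deriv_const smooth_comps Y Z
        smooth_bilinear[OF bounded_bilinear_bform] dir_deriv_bilinear[OF bounded_bilinear_bform])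
  then show ?thesis
    unfolding lie_derivative_def fl[OF Y] fl[OF Z]
    by (simp add: S smooth_lie_bracket X Y Z bform_linear_simps algebra_simps)
qed

lemma linear_frame_lie: "smooth X \<Longrightarrow> linear (frame_lie l X p)"
  unfolding frame_lie_def[abs_def]
  by (intro linear_compose_sub linear_compose[OF linear_frame, unfolded o_def]
      smooth_linear_derivative smooth_comps
      bounded_linear.linear[OF bounded_bilinear.bounded_linear_right[OF bounded_bilinear_frame_bracket]])

text \<open>Left-invariant fields realize any pair of vectors at any point, so vanishing on fields
  amounts to pointwise skewness of \<open>frame_lie\<close> with respect to
  \<open>bform m\<close>.\<close>

lemma lie_derivative_vanishes_bform:
  assumes l: "l \<noteq> 0" and c: "c \<noteq> 0" and X: "smooth X"
    and S: "\<forall>Y Z p. smooth Y \<longrightarrow> smooth Z \<longrightarrow> S Y Z p = c * bform m (comps l Y p) (comps l Z p)"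
  shows "lie_derivative_vanishes X S \<longleftrightarrow>
    (\<forall>p u v. bform m (frame_lie l X p u) v + bform m u (frame_lie l X p v) = 0)"
proof
  assume L: "lie_derivative_vanishes X S"
  show "\<forall>p u v. bform m (frame_lie l X p u) v + bform m u (frame_lie l X p v) = 0"
  proof (intro allI)
    fix p u v
    have s: "smooth (\<lambda>p. frame l p w)" for w
      by (intro smooth_frame smooth_const)
    have "lie_derivative X S (\<lambda>p. frame l p u) (\<lambda>p. frame l p v) p = 0"
      using L s by (simp add: lie_derivative_vanishes_def)
    then show "bform m (frame_lie l X p u) v + bform m u (frame_lie l X p v) = 0"
      using c by (simp add: lie_derivative_bform[OF l X s s S] comps_frame[OF l])
  qed
next
  assume "\<forall>p u v. bform m (frame_lie l X p u) v + bform m u (frame_lie l X p v) = 0"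
  then show "lie_derivative_vanishes X S"
    unfolding lie_derivative_vanishes_def by (auto simp: lie_derivative_bform[OF l X _ _ S])
qed

text \<open>The skewness condition is symmetric and bilinear in \<open>u\<close> and
  \<open>v\<close>, so it is equivalent to six equations, one for each unordered pair of basis
  vectors.\<close>

lemma skew_bform_iff:
  assumes "linear K"
  shows "(\<forall>u v. bform m (K u) v + bform m u (K v) = 0) \<longleftrightarrow>
    K (axis 1 1) $ 1 = 0 \<and> K (axis 2 1) $ 2 = 0 \<and> m * K (axis 3 1) $ 3 = 0 \<and>
    K (axis 1 1) $ 2 = K (axis 2 1) $ 1 \<and>
    m * K (axis 1 1) $ 3 = K (axis 3 1) $ 1 \<and> m * K (axis 2 1) $ 3 = - K (axis 3 1) $ 2"
  (is "?L \<longleftrightarrow> ?R")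
proof
  assume ?L
  then have "bform m (K (axis i 1)) (axis j 1) + bform m (axis i 1) (K (axis j 1)) = 0" for i j
    by blast
  from this[of 1 1] this[of 2 2] this[of 3 3] this[of 1 2] this[of 1 3] this[of 2 3]
  show ?R
    by (simp add: bform_def axis_def)
next
  assume R: ?R
  show ?L
  proof (intro allI)
    fix u v
    have K: "K w = w $ 1 *\<^sub>R K (axis 1 1) + w $ 2 *\<^sub>R K (axis 2 1) + w $ 3 *\<^sub>R K (axis 3 1)" for w
      using vec_3_expand[of w] linear_add[OF assms] linear_scale[OF assms] by metis
    have r: "K (axis 1 1) $ 1 = 0" "K (axis 2 1) $ 2 = 0" "m * K (axis 3 1) $ 3 = 0"
      "K (axis 1 1) $ 2 = K (axis 2 1) $ 1" "K (axis 3 1) $ 1 = m * K (axis 1 1) $ 3"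
      "K (axis 3 1) $ 2 = - (m * K (axis 2 1) $ 3)"
      using R by auto
    show "bform m (K u) v + bform m u (K v) = 0"
      using r(3) unfolding K[of u] K[of v] bform_def by (auto simp: r(1,2,4-6) algebra_simps)
  qed
qed

section \<open>The differential equations for the components of a collineation\<close>

lemma frame_lie_axis:
  assumes "smooth X"
  shows "frame_lie l X p (axis i 1) $ j =
    frame_deriv l i (\<lambda>q. comps l X q $ j) p - frame_bracket l (comps l X p) (axis i 1) $ j"
  using dir_deriv_nth[OF smooth_comps[OF assms], of "frame_field l i" l j p]
  by (simp add: frame_lie_def frame_deriv_def) (simp add: dir_deriv_def frame_field_def)

lemma frame_deriv_const: "frame_deriv l i (\<lambda>q. c) p = 0"
  by (simp add: frame_deriv_def dir_deriv_const)

text \<open>The mixed components \<open>A = E\<^sub>3 f\<^sub>1\<close> and \<open>B = E\<^sub>3 f\<^sub>2\<close> satisfy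
  \<open>E\<^sub>3 A = - m l B\<close> and \<open>E\<^sub>3 B = - m l A\<close>. As \<open>E\<^sub>3\<close> is central, \<open>E\<^sub>1 A = 0\<close> and \<open>E\<^sub>2 B = 0\<close>
  then propagate to \<open>E\<^sub>1 B = E\<^sub>2 A = 0\<close>, and the commutator \<open>[E\<^sub>1, E\<^sub>2] = - l E\<^sub>3\<close> annihilates \<open>A\<close>.\<close>
lemma skew_frame_mixed_zero:
  assumes l: "l \<noteq> 0" and m: "m \<noteq> 0"
    and f1: "smooth f1" and f2: "smooth f2" and f3: "smooth f3"
    and e11: "\<And>p. frame_deriv l 1 f1 p = 0" and e22: "\<And>p. frame_deriv l 2 f2 p = 0"
    and e33: "\<And>p. frame_deriv l 3 f3 p = 0"
    and e13: "\<And>p. frame_deriv l 3 f1 p = m * (frame_deriv l 1 f3 p - l * f2 p)"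
    and e23: "\<And>p. frame_deriv l 3 f2 p = - (m * (frame_deriv l 2 f3 p + l * f1 p))"
  shows "frame_deriv l 3 f1 p = 0" and "frame_deriv l 3 f2 p = 0"
proof -
  define A where "A = frame_deriv l 3 f1"
  define B where "B = frame_deriv l 3 f2"
  have sA: "smooth A" and sB: "smooth B"
    by (simp_all add: A_def B_def smooth_frame_deriv f1 f2)
  have fun0: "frame_deriv l 1 f1 = (\<lambda>q. 0)" "frame_deriv l 2 f2 = (\<lambda>q. 0)" "frame_deriv l 3 f3 = (\<lambda>q. 0)"
    using e11 e22 e33 by auto
  have d_mult: "frame_deriv l i (\<lambda>q. k * g q) p = k * frame_deriv l i g p" if "smooth g" for i k g p
    using that by (simp add: frame_deriv_def dir_deriv_mult smooth_const dir_deriv_const)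
  have E1A: "frame_deriv l 1 A p = 0" for p
    unfolding A_def frame_deriv_commutators(2)[OF l f1] fun0 by (rule frame_deriv_const)
  have E2B: "frame_deriv l 2 B p = 0" for p
    unfolding B_def frame_deriv_commutators(3)[OF l f2] fun0 by (rule frame_deriv_const)
  have A: "A = (\<lambda>q. m * (frame_deriv l 1 f3 q - l * f2 q))"
    and B: "B = (\<lambda>q. - m * (frame_deriv l 2 f3 q + l * f1 q))"
    using e13 e23 by (auto simp: A_def B_def)
  \<comment> \<open>Differentiate the mixed equation along \<open>E_3\<close>: since
    \<open>E_3\<close> commutes with \<open>E_1\<close> and kills \<open>f3\<close>, only the term
    with \<open>f2\<close> survives. The computation of \<open>E3B\<close> is analogous.\<close>
  have E3A: "frame_deriv l 3 A p = - (m * l) * B p" for p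
  proof -
    have "frame_deriv l 3 A p = m * (frame_deriv l 3 (frame_deriv l 1 f3) p - l * frame_deriv l 3 f2 p)"
      unfolding A
      by (simp add: d_mult smooth_minus smooth_frame_deriv f3 f2 smooth_mult smooth_const)
         (simp add: frame_deriv_def[of l 3] dir_deriv_minus smooth_frame_deriv f3 f2 smooth_mult smooth_const
            d_mult[of f2, unfolded frame_deriv_def])
    then show ?thesis
      by (simp add: frame_deriv_commutators(2)[OF l f3, symmetric] fun0 frame_deriv_const B_def)
  qed
  have E3B: "frame_deriv l 3 B p = - (m * l) * A p" for p
  proof -
    have "frame_deriv l 3 B p = - m * (frame_deriv l 3 (frame_deriv l 2 f3) p + l * frame_deriv l 3 f1 p)"
      unfolding B
      by (subst d_mult, intro smooth_plus smooth_mult smooth_const smooth_frame_deriv f3 f1)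
         (simp add: frame_deriv_def[of l 3] dir_deriv_plus smooth_frame_deriv f3 f1 smooth_mult smooth_const
            d_mult[of f1, unfolded frame_deriv_def])
    then show ?thesis
      by (simp add: frame_deriv_commutators(3)[OF l f3, symmetric] fun0 frame_deriv_const A_def)
  qed
  have E1B: "frame_deriv l 1 B p = 0" for p
  proof -
    have "- (m * l) * frame_deriv l 1 B p = frame_deriv l 1 (frame_deriv l 3 A) p"
      using E3A d_mult[OF sB, of 1 "- (m * l)" p] by (simp add: fun_eq_iff[symmetric] E3A[abs_def])
    also have "\<dots> = 0"
      unfolding frame_deriv_commutators(2)[OF l sA] E1A[abs_def] by (rule frame_deriv_const)
    finally show ?thesis
      using l m by simp
  qed
  have E2A: "frame_deriv l 2 A p = 0" for p
  proof -
    have "- (m * l) * frame_deriv l 2 A p = frame_deriv l 2 (frame_deriv l 3 B) p"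
      using E3B d_mult[OF sA, of 2 "- (m * l)" p] by (simp add: fun_eq_iff[symmetric] E3B[abs_def])
    also have "\<dots> = 0"
      unfolding frame_deriv_commutators(3)[OF l sB] E2B[abs_def] by (rule frame_deriv_const)
    finally show ?thesis
      using l m by simp
  qed
  have zero: "frame_deriv l 3 g p = 0"
    if g: "smooth g" "\<And>p. frame_deriv l 1 g p = 0" "\<And>p. frame_deriv l 2 g p = 0" for g p
    using frame_deriv_commutators(1)[OF l g(1), of p] l
    by (simp add: g(2)[abs_def] g(3)[abs_def] frame_deriv_const)
  \<comment> \<open>Once \<open>E_3\<close> kills \<open>A\<close> and \<open>B\<close>, the
    relations \<open>E3A\<close> and \<open>E3B\<close> express each of the two as a multiple of
    zero.\<close>
  have "B p = 0" "A p = 0"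
    using zero[OF sA E1A E2A, of p] zero[OF sB E1B E2B, of p] E3A[of p] E3B[of p] l m by auto
  then show "frame_deriv l 3 f1 p = 0" "frame_deriv l 3 f2 p = 0"
    by (simp_all add: A_def B_def)
qed

text \<open>Neither \<open>c\<close> nor \<open>m\<close> occurs in the resulting system, so all
  tensors of this form share their collineations.\<close>

lemma lie_derivative_vanishes_bform_iff:
  fixes X :: vector_field and l :: real
  defines "f \<equiv> \<lambda>i q. comps l X q $ i"
  assumes l: "l \<noteq> 0" and c: "c \<noteq> 0" and m: "m \<noteq> 0" and X: "smooth X"
    and S: "\<forall>Y Z p. smooth Y \<longrightarrow> smooth Z \<longrightarrow> S Y Z p = c * bform m (comps l Y p) (comps l Z p)"
  shows "lie_derivative_vanishes X S \<longleftrightarrow>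
    (\<forall>p. frame_deriv l 1 (f 1) p = 0 \<and> frame_deriv l 2 (f 2) p = 0 \<and> frame_deriv l 3 (f 3) p = 0 \<and>
      frame_deriv l 1 (f 2) p = frame_deriv l 2 (f 1) p \<and>
      frame_deriv l 3 (f 1) p = 0 \<and> frame_deriv l 3 (f 2) p = 0 \<and>
      frame_deriv l 1 (f 3) p = l * f 2 p \<and> frame_deriv l 2 (f 3) p = - l * f 1 p)"
  (is "_ \<longleftrightarrow> (\<forall>p. ?E p)")
proof -
  have br: "frame_bracket l (comps l X p) (axis i 1) $ j =
      (if j = 3 then if i = 1 then l * f 2 p else if i = 2 then - l * f 1 p else 0 else 0)" for i j p
    using exhaust_3[of j] by (auto simp: frame_bracket_def axis_def f_def)
  have "lie_derivative_vanishes X S \<longleftrightarrow>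
    (\<forall>p. frame_deriv l 1 (f 1) p = 0 \<and> frame_deriv l 2 (f 2) p = 0 \<and> frame_deriv l 3 (f 3) p = 0 \<and>
      frame_deriv l 1 (f 2) p = frame_deriv l 2 (f 1) p \<and>
      m * (frame_deriv l 1 (f 3) p - l * f 2 p) = frame_deriv l 3 (f 1) p \<and>
      m * (frame_deriv l 2 (f 3) p + l * f 1 p) = - frame_deriv l 3 (f 2) p)"
    (is "_ \<longleftrightarrow> (\<forall>p. ?K p)")
    unfolding lie_derivative_vanishes_bform[OF l c X S] skew_bform_iff[OF linear_frame_lie[OF X]]
      frame_lie_axis[OF X] br
    using m by (simp add: f_def)
  also have "\<dots> \<longleftrightarrow> (\<forall>p. ?E p)"
  proof
    assume K: "\<forall>p. ?K p"
    have sf: "smooth (f i)" for i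
      unfolding f_def by (intro smooth_nth smooth_comps X)
    \<comment> \<open>Both mixed equations now have a zero side, and \<open>m\<close> can be divided
      out.\<close>
    have "frame_deriv l 3 (f 1) p = 0" "frame_deriv l 3 (f 2) p = 0" for p
      using K by (intro skew_frame_mixed_zero[OF l m sf[of 1] sf[of 2] sf[of 3]]; simp)+
    with K m show "\<forall>p. ?E p"
      by (simp add: eq_neg_iff_add_eq_0)
  next
    assume "\<forall>p. ?E p"
    then show "\<forall>p. ?K p"
      by simp
  qed
  finally show ?thesis .
qed

theorem mainTheorem14:
  fixes l :: real and X :: vector_field
  assumes "l \<noteq> 0" and "smooth X"
  shows "(matter_collineation (g1 l) X \<longleftrightarrow> ricci_collineation (g1 l) X) \<and>
         (ricci_collineation (g1 l) X \<longleftrightarrow> killing (g1 l) X)"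
proof -
  \<comment> \<open>The two tensors enter with different pairs of \<open>c\<close> and
    \<open>m\<close> but yield the same system. The comparison of the Ricci tensor with the metric
    below works in the same way.\<close>
  have "lie_derivative_vanishes X (energy_momentum (g1 l)) \<longleftrightarrow> lie_derivative_vanishes X (ricci (g1 l))"
    using lie_derivative_vanishes_bform_iff[of l "l\<^sup>2 / 4" "- 3" X "energy_momentum (g1 l)"]
      lie_derivative_vanishes_bform_iff[of l "l\<^sup>2 / 2" "- 1" X "ricci (g1 l)"] assms
    by (simp add: energy_momentum_g1 ricci_g1)
  moreover have "lie_derivative_vanishes X (ricci (g1 l)) \<longleftrightarrow> lie_derivative_vanishes X (g1 l)"
    using lie_derivative_vanishes_bform_iff[of l "l\<^sup>2 / 2" "- 1" X "ricci (g1 l)"]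
      lie_derivative_vanishes_bform_iff[of l 1 1 X "g1 l"] assms
    by (simp add: ricci_g1 g1_eq_bform)
  ultimately show ?thesis
    using assms by (simp add: matter_collineation_def ricci_collineation_def killing_def)
qed

end
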